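(* Let $p$ be an odd prime. Let $(u_n)_{n\ge0}$ and $(v_n)_{n\ge 0}$ be the integer sequences with $u_0=0$, $u_1=1$, $u_{n+1}=4u_n-2u_{n-1}$ and $v_0=2$, $v_1=4$, $v_{n+1}=4v_n-2v_{n-1}$ for $n\ge1$. Then $$\sum_{k=0}^{p-1}\frac{u_k}{2^k}\binom{2k}{k}\equiv\left(\frac{-1}p\right)-\left(\frac{-2}p\right)\pmod{p^2}$$ and $$\sum_{k=0}^{p-1}\frac{u_{k+1}}{2^k}\binom{2k}{k}\equiv\left(\frac{-1}p\right)\pmod{p^2}.$$ Also, $$\sum_{k=0}^{(p-1)/2}\frac{u_k}{16^k}\binom{2k}{k}\equiv\frac{(-1)^{\lfloor (p-4)/8\rfloor}}{2}\left(1-\left(\frac 2p\right)\right)\pmod{p^2}$$ and $$\sum_{k=0}^{(p-1)/2}\frac{v_k}{16^k}\binom{2k}{k}\equiv2(-1)^{\lfloor p/8\rfloor}\left(\frac{-1}p\right)\pmod{p^2}.$$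
   Context: $\left(\frac{\cdot}{\cdot}\right)$ is the Jacobi (Legendre) symbol. A congruence $a\equiv b\pmod{p^2}$ between rational numbers whose denominators are prime to $p$ means $a-b\in p^2\mathbb{Z}_{(p)}$. (The sequences $u_n=u_n(4,2)$, $v_n=v_n(4,2)$ are the Lucas sequence and companion Lucas sequence with parameters $A=4$, $B=2$; $v_n=\alpha^n+\beta^n$ for the roots $\alpha,\beta$ of $x^2-4x+2=0$.) The floor is the usual one, so $\lfloor -1/8\rfloor=-1$. *)

theory Defs
  imports "HOL-Number_Theory.Number_Theory"
begin

text \<open>The localization of the integers at \<open>(p)\<close> inside the rationals, for a prime \<open>p\<close>.\<close>

definition localized_ints :: "nat \<Rightarrow> rat set" where
  "localized_ints p = {x. \<exists>a b :: int. \<not> int p dvd b \<and> x = of_int a / of_int b}"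

text \<open>\<open>rat_cong p m a b\<close> is the congruence \<open>a \<equiv> b (mod m)\<close> in the localization at \<open>(p)\<close>,
  that is, \<open>a - b\<close> lies in the ideal of it generated by \<open>m\<close>. The library's \<open>cong\<close> is not
  suitable here: in a field it ignores divisibility by \<open>p\<close>.\<close>

definition rat_cong :: "nat \<Rightarrow> nat \<Rightarrow> rat \<Rightarrow> rat \<Rightarrow> bool" where
  "rat_cong p m a b \<longleftrightarrow> (\<exists>x \<in> localized_ints p. a - b = of_nat m * x)"

end

theory Submission
  imports Defs
begin

text \<open>
  Write \<open>U\<^sub>n\<close> for \<open>lucas_one c n\<close>, where \<open>p = 2n + 1\<close> and \<open>m = c + 2\<close>.
  The identity \<open>\<Sum>k<p. binom(2k,k) m^(p-1-k) = \<Sum>k\<le>p. binom(2p,k) U\<^sub>p\<^sub>-\<^sub>k\<close> and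
  \<open>binom(2p,k) \<equiv> 2 binom(p,k) (mod p^2)\<close> reduce the left-hand side to \<open>2T - U\<^sub>p\<close> with
  \<open>T = \<Sum>k\<le>p. binom(p,k) U\<^sub>k = m^n (U\<^sub>n + U\<^sub>n\<^sub>+\<^sub>1)\<close>. Since \<open>T \<equiv> U\<^sub>p (mod p)\<close>, completing the
  square gives \<open>2T - U\<^sub>p \<equiv> U\<^sub>p T^2 (mod p^2)\<close> whenever \<open>U\<^sub>p^2 = 1\<close>.
  Take \<open>c = -sqrt 2\<close>, so that \<open>U\<close> has period 8 and \<open>m = 2 - sqrt 2\<close> is \<open>2 / (2 + sqrt 2)\<close>; comparing
  coefficients in \<open>\<int>[sqrt 2]\<close> yields the first two congruences.
  For the sums up to \<open>n\<close>, \<open>binom(2k,k) \<equiv> (-16)^k binom(n+k,2k) (mod p^2)\<close>, and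
  \<open>\<Sum>k\<le>n. binom(n+k,2k) (-a)^k\<close> with \<open>a = 2 + sqrt 2\<close> is \<open>U\<^sub>n\<^sub>+\<^sub>1 - U\<^sub>n\<close> for the same \<open>c\<close>.
\<close>

section \<open>Lucas sequences and binomial sums\<close>

text \<open>The Lucas sequence with parameters \<open>c\<close> and 1, that is, the Chebyshev
  polynomials of the second kind in \<open>c / 2\<close> with index shifted by one. The ring stays
  general because both \<open>int\<close> and \<int>[sqrt 2] occur below.\<close>

fun lucas_one :: "'a :: comm_ring_1 \<Rightarrow> nat \<Rightarrow> 'a" where
  "lucas_one c 0 = 0"
| "lucas_one c (Suc 0) = 1"
| "lucas_one c (Suc (Suc n)) = c * lucas_one c (Suc n) - lucas_one c n"

text \<open>Pascal's rule in operator form: passing to the next row applies \<open>1 + E\<close> to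
  \<open>f\<close>, where \<open>E\<close> is the shift.\<close>

lemma sum_choose_Suc:
  fixes f :: "nat \<Rightarrow> 'a :: comm_ring_1"
  shows "(\<Sum>k\<le>Suc n. of_nat (Suc n choose k) * f k) =
         (\<Sum>k\<le>n. of_nat (n choose k) * (f k + f (Suc k)))"
proof -
  have "(\<Sum>k\<le>Suc n. of_nat (Suc n choose k) * f k) =
        f 0 + (\<Sum>k\<le>n. of_nat (n choose Suc k) * f (Suc k)) + (\<Sum>k\<le>n. of_nat (n choose k) * f (Suc k))"
    by (simp only: sum.atMost_Suc_shift binomial_Suc_Suc of_nat_add distrib_right sum.distrib) simp
  also have "f 0 + (\<Sum>k\<le>n. of_nat (n choose Suc k) * f (Suc k)) =
        (\<Sum>k\<le>Suc n. of_nat (n choose k) * f k)"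
    by (simp only: sum.atMost_Suc_shift) simp
  also have "\<dots> = (\<Sum>k\<le>n. of_nat (n choose k) * f k)"
    by (simp add: binomial_eq_0)
  finally show ?thesis
    by (simp only: distrib_left sum.distrib)
qed

lemma sum_choose_Suc_Suc:
  fixes f :: "nat \<Rightarrow> 'a :: comm_ring_1"
  shows "(\<Sum>k\<le>Suc (Suc n). of_nat (Suc (Suc n) choose k) * f k) =
         (\<Sum>k\<le>n. of_nat (n choose k) * (f k + 2 * f (Suc k) + f (Suc (Suc k))))"
  by (simp only: sum_choose_Suc) (simp add: algebra_simps)

text \<open>On solutions of the recurrence \<open>E^2 = c E - 1\<close>, so two rows of Pascal's
  triangle contribute \<open>(1 + E)^2 = (c + 2) E\<close>. The start \<open>r\<close> is arbitrary
  because each such step shifts it.\<close>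

lemma sum_choose_even_lucas_one:
  "(\<Sum>k\<le>2 * n. of_nat (2 * n choose k) * lucas_one c (r + k)) = (c + 2) ^ n * lucas_one c (r + n)"
proof (induction n arbitrary: r)
  case (Suc n)
  have "(\<Sum>k\<le>2 * Suc n. of_nat (2 * Suc n choose k) * lucas_one c (r + k)) =
        (\<Sum>k\<le>2 * n. of_nat (2 * n choose k) * ((c + 2) * lucas_one c (Suc r + k)))"
    using sum_choose_Suc_Suc[of "2 * n" "\<lambda>k. lucas_one c (r + k)"]
    by (simp add: algebra_simps)
  also have "\<dots> = (c + 2) * ((c + 2) ^ n * lucas_one c (Suc r + n))"
    by (simp only: Suc.IH[symmetric] sum_distrib_left mult.left_commute)
  finally show ?case by simp
qed simp

lemma sum_choose_odd_lucas_one: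
  "(\<Sum>k\<le>2 * n + 1. of_nat (2 * n + 1 choose k) * lucas_one c k) =
   (c + 2) ^ n * (lucas_one c n + lucas_one c (n + 1))"
  using sum_choose_Suc[of "2 * n" "lucas_one c"]
    sum_choose_even_lucas_one[of n c 0] sum_choose_even_lucas_one[of n c 1]
  by (simp add: distrib_left sum.distrib)

text \<open>Both sides satisfy \<open>S (n + 1) = (c + 2) * S n + binom(2n, n)\<close>.\<close>

lemma sum_central_binomial_lucas_one:
  "(\<Sum>k<n. of_nat (2 * k choose k) * (c + 2) ^ (n - Suc k)) =
   (\<Sum>k\<le>2 * n. of_nat (2 * n choose k) * lucas_one c (n - k))"
proof (induction n)
  case (Suc n)
  \<comment> \<open>Truncated subtraction makes all terms vanish for \<open>k > n\<close>. At
    \<open>k = n\<close> it puts 0 in place of the value -1 that the recurrence gives at index -1;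
    this leaves the extra 1, the source of the central binomial coefficient.\<close>
  have step: "lucas_one c (Suc n - k) + 2 * lucas_one c (Suc n - Suc k)
      + lucas_one c (Suc n - Suc (Suc k)) =
      (c + 2) * lucas_one c (n - k) + (if k = n then 1 else 0)" for k
  proof (cases "k < n")
    case True
    then obtain d where "n = Suc (k + d)" using less_imp_Suc_add by blast
    then show ?thesis by (simp add: Suc_diff_le algebra_simps)
  qed (auto simp: not_less Suc_diff_le)
  have "(\<Sum>k\<le>2 * Suc n. of_nat (2 * Suc n choose k) * lucas_one c (Suc n - k)) =
    (\<Sum>k\<le>2 * n. of_nat (2 * n choose k) *
      ((c + 2) * lucas_one c (n - k) + (if k = n then 1 else 0)))"
    using sum_choose_Suc_Suc[of "2 * n" "\<lambda>k. lucas_one c (Suc n - k)"] by (simp only: step) simp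
  also have "\<dots> = (c + 2) * (\<Sum>k\<le>2 * n. of_nat (2 * n choose k) * lucas_one c (n - k))
      + of_nat (2 * n choose n)"
    by (simp add: distrib_left sum.distrib sum_distrib_left mult.left_commute
        flip: of_bool_def)
  also have "\<dots> = (c + 2) * (\<Sum>k<n. of_nat (2 * k choose k) * (c + 2) ^ (n - Suc k))
      + of_nat (2 * n choose n)"
    by (simp only: Suc.IH)
  also have "\<dots> = (\<Sum>k<n. of_nat (2 * k choose k) * (c + 2) ^ Suc (n - Suc k))
      + of_nat (2 * n choose n)"
    by (simp add: sum_distrib_left mult.left_commute)
  also have "\<dots> = (\<Sum>k<Suc n. of_nat (2 * k choose k) * (c + 2) ^ (Suc n - Suc k))"
    by (simp add: Suc_diff_Suc del: power_Suc)
  finally show ?case by simp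
qed simp

section \<open>The sum up to p - 1 modulo p^2\<close>

text \<open>In Vandermonde's convolution the two end terms give \<open>2 * (p choose k)\<close>;
  every inner term is a product of two multiples of \<open>p\<close>.\<close>

lemma prime_square_dvd_choose_double_diff:
  assumes p: "prime (p :: nat)" and k: "0 < k" "k < p"
  shows "int (p ^ 2) dvd int (2 * p choose k) - 2 * int (p choose k)"
proof -
  have "(2 * p choose k) = (\<Sum>j\<le>k. (p choose j) * (p choose (k - j)))"
    using vandermonde[of p p k] by (simp add: mult_2)
  also have "\<dots> = (p choose 0) * (p choose k) + (p choose k) * (p choose 0)
      + (\<Sum>j\<in>{0<..<k}. (p choose j) * (p choose (k - j)))"
  proof -
    have "{..k} = insert 0 (insert k {0<..<k})" using k by auto
    then show ?thesis using k by (simp add: add.assoc)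
  qed
  finally have "int (2 * p choose k) - 2 * int (p choose k) =
      int (\<Sum>j\<in>{0<..<k}. (p choose j) * (p choose (k - j)))"
    by simp
  moreover have "p ^ 2 dvd (\<Sum>j\<in>{0<..<k}. (p choose j) * (p choose (k - j)))"
  proof (rule dvd_sum)
    fix j assume "j \<in> {0<..<k}"
    then have "p dvd (p choose j)" "p dvd (p choose (k - j))"
      using k p by (auto intro!: dvd_choose_prime)
    then show "p ^ 2 dvd (p choose j) * (p choose (k - j))"
      unfolding power2_eq_square by (rule mult_dvd_mono)
  qed
  ultimately show ?thesis
    by (simp only: int_dvd_int_iff)
qed

lemma of_int_dvd_of_int: "a dvd b \<Longrightarrow> (of_int a :: 'a :: comm_ring_1) dvd of_int b"
  by (elim dvdE) simp

lemma prime_square_dvd_sum_central_binomial: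
  fixes c :: "'a :: comm_ring_1"
  assumes p: "prime p"
  shows "of_nat p ^ 2 dvd
    (\<Sum>k<p. of_nat (2 * k choose k) * (c + 2) ^ (p - Suc k))
    - (2 * (\<Sum>k\<le>p. of_nat (p choose k) * lucas_one c k) - lucas_one c p)"
proof -
  have "(\<Sum>k\<le>2 * p. of_nat (2 * p choose k) * lucas_one c (p - k)) =
    (\<Sum>k<p. of_nat (2 * p choose k) * lucas_one c (p - k))"
    by (rule sum.mono_neutral_right) auto
  moreover have "(\<Sum>k\<le>p. of_nat (p choose k) * lucas_one c k) =
    (\<Sum>k\<le>p. of_nat (p choose k) * lucas_one c (p - k))"
    using sum.atLeastAtMost_rev[of "\<lambda>k. of_nat (p choose k) * lucas_one c k" 0 p]
    by (simp add: atLeast0AtMost binomial_symmetric[symmetric])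
  moreover have "\<dots> = (\<Sum>k<p. of_nat (p choose k) * lucas_one c (p - k))"
    by (rule sum.mono_neutral_right) auto
  \<comment> \<open>At \<open>k = 0\<close> the binomial congruence fails by exactly 1, since
    \<open>1 = 2 * 1 - 1\<close>. Writing \<open>lucas_one c p\<close> as a sum supported at 0
    absorbs this defect.\<close>
  moreover have "lucas_one c p = (\<Sum>k<p. (if k = 0 then lucas_one c (p - k) else 0))"
    using prime_gt_0_nat[OF p] by simp
  ultimately have "(\<Sum>k<p. of_nat (2 * k choose k) * (c + 2) ^ (p - Suc k))
    - (2 * (\<Sum>k\<le>p. of_nat (p choose k) * lucas_one c k) - lucas_one c p) =
    (\<Sum>k<p. of_nat (2 * p choose k) * lucas_one c (p - k)
      - (2 * (of_nat (p choose k) * lucas_one c (p - k))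
        - (if k = 0 then lucas_one c (p - k) else 0)))"
    by (simp only: sum_central_binomial_lucas_one sum_subtractf sum_distrib_left)
  also have "\<dots> =
    (\<Sum>k<p. (of_int (int (2 * p choose k) - 2 * int (p choose k) + (if k = 0 then 1 else 0))
       * lucas_one c (p - k)))"
    by (intro sum.cong refl) (simp add: algebra_simps)
  also have "of_nat p ^ 2 dvd \<dots>"
  proof (intro dvd_sum dvd_mult2)
    fix k assume "k \<in> {..<p}"
    then have "int (p ^ 2) dvd
        int (2 * p choose k) - 2 * int (p choose k) + (if k = 0 then 1 else 0)"
      using prime_square_dvd_choose_double_diff[OF p, of k] by auto
    then show "of_nat p ^ 2 dvd (of_int (int (2 * p choose k) - 2 * int (p choose k)
        + (if k = 0 then 1 else 0)) :: 'a)"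
      by (metis of_int_dvd_of_int of_int_of_nat_eq of_nat_power)
  qed
  finally show ?thesis .
qed

lemma prime_dvd_sum_choose_diff:
  fixes f :: "nat \<Rightarrow> 'a :: comm_ring_1"
  assumes p: "prime p"
  shows "of_nat p dvd (\<Sum>k\<le>p. of_nat (p choose k) * f k) - (f 0 + f p)"
proof -
  have "{..p} = insert 0 (insert p {0<..<p})"
    by auto
  then have "(\<Sum>k\<le>p. of_nat (p choose k) * f k) =
      f 0 + (f p + (\<Sum>k\<in>{0<..<p}. of_nat (p choose k) * f k))"
    using prime_gt_0_nat[OF p] by simp
  then have "(\<Sum>k\<le>p. of_nat (p choose k) * f k) - (f 0 + f p) =
      (\<Sum>k\<in>{0<..<p}. of_nat (p choose k) * f k)"
    by simp
  also have "of_nat p dvd \<dots>"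
  proof (intro dvd_sum dvd_mult2)
    fix k assume "k \<in> {0<..<p}"
    then have "p dvd (p choose k)" using p by (auto intro!: dvd_choose_prime)
    then show "of_nat p dvd (of_nat (p choose k) :: 'a)"
      by (elim dvdE) simp
  qed
  finally show ?thesis .
qed

text \<open>Completing the square replaces \<open>T\<close>, which contains
  \<open>(c + 2) ^ n\<close>, by \<open>T ^ 2\<close>, which contains
  \<open>(c + 2) ^ (p - 1)\<close>. That power can later be combined with \<open>a ^ (p - 1)\<close>
  into a power of an integer.\<close>

lemma prime_square_dvd_sum_central_binomial_square:
  fixes c :: "'a :: comm_ring_1"
  assumes p: "prime p" "p = 2 * n + 1" and unit: "lucas_one c p ^ 2 = 1"
  shows "of_nat p ^ 2 dvd
    (\<Sum>k<p. of_nat (2 * k choose k) * (c + 2) ^ (p - Suc k))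
    - (c + 2) ^ (p - 1) * (lucas_one c p * (lucas_one c n + lucas_one c (n + 1)) ^ 2)"
    (is "_ dvd ?S - _")
proof -
  define T where "T = (\<Sum>k\<le>p. of_nat (p choose k) * lucas_one c k)"
  define e where "e = lucas_one c p"
  have T: "T = (c + 2) ^ n * (lucas_one c n + lucas_one c (n + 1))"
    unfolding T_def p(2) by (rule sum_choose_odd_lucas_one)
  have "of_nat p dvd T - e"
    using prime_dvd_sum_choose_diff[OF p(1), of "lucas_one c"] by (simp add: T_def e_def)
  then have "of_nat p ^ 2 dvd (T - e) ^ 2"
    by (rule dvd_power_same)
  then have "of_nat p ^ 2 dvd (?S - (2 * T - e)) - e * (T - e) ^ 2"
    using prime_square_dvd_sum_central_binomial[OF p(1), of c]
    unfolding T_def e_def by - (rule dvd_diff, assumption, rule dvd_mult)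
  also have "e * (T - e) ^ 2 = e * T ^ 2 - 2 * T * e ^ 2 + e * e ^ 2"
    by (simp add: power2_eq_square algebra_simps)
  also have "\<dots> = e * T ^ 2 - 2 * T + e"
    using unit by (simp add: e_def)
  also have "(?S - (2 * T - e)) - (e * T ^ 2 - 2 * T + e) = ?S - e * T ^ 2"
    by simp
  also have "e * T ^ 2 = (c + 2) ^ (p - 1) * (e * (lucas_one c n + lucas_one c (n + 1)) ^ 2)"
    unfolding T p(2) by (simp add: power_mult_distrib power_mult[symmetric] mult_ac)
  finally show ?thesis by (simp add: e_def)
qed

section \<open>The sum up to (p - 1) / 2 modulo p^2\<close>

text \<open>These are Morgan-Voyce polynomials. Pascal's rule couples the even-index sums
  \<open>F\<close> with the odd-index sums \<open>G\<close>, and eliminating \<open>F\<close> leaves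
  the Lucas recurrence with parameter \<open>y + 2\<close> for \<open>G\<close>.\<close>

lemma sum_choose_add_double:
  fixes y :: "'a :: comm_ring_1"
  shows "(\<Sum>k\<le>n. of_nat (n + k choose (2 * k)) * y ^ k) =
    lucas_one (y + 2) (Suc n) - lucas_one (y + 2) n"
proof -
  define F where "F n = (\<Sum>k\<le>n. of_nat (n + k choose (2 * k)) * y ^ k)" for n
  define G where "G n = (\<Sum>k<n. of_nat (n + k choose (2 * k + 1)) * y ^ k)" for n
  have G: "G (Suc n) = G n + F n" for n
  proof -
    \<comment> \<open>The added term \<open>k = n\<close> is zero; it gives \<open>G n\<close> the
      same range as \<open>F n\<close>.\<close>
    have "G n = (\<Sum>k<Suc n. of_nat (n + k choose (2 * k + 1)) * y ^ k)"
      by (simp add: G_def binomial_eq_0)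
    then show ?thesis
      by (simp add: G_def F_def lessThan_Suc_atMost algebra_simps sum.distrib del: sum.lessThan_Suc)
  qed
  have F: "F (Suc n) = F n + y * G (Suc n)" for n
  proof -
    have "F (Suc n) = 1 + (\<Sum>k\<le>n. of_nat (Suc n + Suc k choose (2 * Suc k)) * y ^ Suc k)"
      by (simp only: F_def sum.atMost_Suc_shift) simp
    also have "\<dots> = 1 + (\<Sum>k\<le>n. of_nat (n + Suc k choose (2 * Suc k)) * y ^ Suc k)
        + (\<Sum>k\<le>n. of_nat (Suc n + k choose (2 * k + 1)) * y ^ Suc k)"
      by (simp only: binomial_Suc_Suc add_Suc add_Suc_right mult_Suc_right numeral_2_eq_2
          add_0_left mult_0 mult_Suc of_nat_add distrib_right sum.distrib One_nat_def add_0_right)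
         (simp add: algebra_simps binomial_eq_0)
    also have "1 + (\<Sum>k\<le>n. of_nat (n + Suc k choose (2 * Suc k)) * y ^ Suc k) =
        (\<Sum>k\<le>Suc n. of_nat (n + k choose (2 * k)) * y ^ k)"
      by (simp only: sum.atMost_Suc_shift) (simp add: binomial_eq_0)
    also have "\<dots> = F n"
      by (simp add: F_def binomial_eq_0)
    also have "(\<Sum>k\<le>n. of_nat (Suc n + k choose (2 * k + 1)) * y ^ Suc k) = y * G (Suc n)"
      by (simp add: G_def lessThan_Suc_atMost sum_distrib_left algebra_simps del: sum.lessThan_Suc)
    finally show ?thesis .
  qed
  have "G n = lucas_one (y + 2) n \<and> F n = lucas_one (y + 2) (Suc n) - lucas_one (y + 2) n"
  proof (induction n)
    case (Suc n)
    then show ?case by (simp add: G F) (simp add: algebra_simps)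
  qed (simp add: G_def F_def)
  then show ?thesis by (simp add: F_def)
qed

text \<open>Two absorption identities give the ratio of consecutive terms, here cleared of
  denominators.\<close>

lemma choose_add_double_Suc:
  "(n + Suc k choose (2 * Suc k)) * ((2 * k + 1) * (2 * k + 2)) =
   (n + k choose (2 * k)) * ((n + k + 1) * (n - k))"
proof -
  have "(2 * k + 2) * (n + Suc k choose (2 * Suc k)) = (n + k + 1) * (n + k choose (2 * k + 1))"
    using Suc_times_binomial[of "2 * k + 1" "n + k"] by simp
  moreover have "(2 * k + 1) * (n + k choose (2 * k + 1)) = (n - k) * (n + k choose (2 * k))"
    using binomial_absorption[of "2 * k" "n + k"] binomial_absorb_comp[of "n + k" "2 * k"]
    by simp
  ultimately have "(2 * k + 1) * ((2 * k + 2) * (n + Suc k choose (2 * Suc k))) =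
      (n + k + 1) * ((n - k) * (n + k choose (2 * k)))"
    by (simp only: mult.left_commute)
  then show ?thesis
    by (simp only: mult_ac)
qed

lemma central_binomial_Suc:
  "(2 * Suc k choose Suc k) * Suc k = 2 * (2 * k + 1) * (2 * k choose k)"
proof -
  have "Suc k * (2 * Suc k choose Suc k) = 2 * (Suc k * (2 * k + 1 choose k))"
    using Suc_times_binomial[of k "2 * k + 1"] by (simp del: binomial_Suc_Suc)
  also have "Suc k * (2 * k + 1 choose k) = (2 * k + 1) * (2 * k choose k)"
    using binomial_absorb_comp[of "2 * k + 1" k] by simp
  finally show ?thesis by (simp only: mult_ac)
qed

text \<open>Induction by comparing term ratios:
  \<open>4 (n + k + 1) (n - k) = p^2 - (2k + 1)^2\<close>, so modulo \<open>p^2\<close> both ratios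
  are multiples of \<open>(2k + 1)^2\<close> over the same denominator \<open>w\<close>, and they
  differ by the factor -16.\<close>

lemma prime_square_dvd_choose_add_double_diff:
  assumes p: "prime p" "p = 2 * n + 1" and "k \<le> n"
  shows "int p ^ 2 dvd int (2 * k choose k) - (-16) ^ k * int (n + k choose (2 * k))"
  using \<open>k \<le> n\<close>
proof (induction k)
  case (Suc k)
  define C where "C k = int (2 * k choose k)" for k
  define X where "X k = int (n + k choose (2 * k))" for k
  define w where "w = int ((2 * k + 1) * (2 * k + 2))"
  have C: "C (Suc k) * w = 4 * (2 * int k + 1) ^ 2 * C k"
  proof -
    have "C (Suc k) * int (Suc k) = int (2 * (2 * k + 1) * (2 * k choose k))"
      unfolding C_def central_binomial_Suc[symmetric] of_nat_mult ..
    also have "\<dots> = 2 * (2 * int k + 1) * C k"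
      unfolding C_def by (simp only: of_nat_mult of_nat_add) simp
    finally have "C (Suc k) * int (Suc k) * (2 * (2 * int k + 1)) =
        2 * (2 * int k + 1) * C k * (2 * (2 * int k + 1))"
      by (rule arg_cong)
    then show ?thesis by (simp add: w_def algebra_simps power2_eq_square)
  qed
  have X: "4 * X (Suc k) * w = X k * (int p ^ 2 - (2 * int k + 1) ^ 2)"
  proof -
    have "X (Suc k) * w = int ((n + k choose (2 * k)) * ((n + k + 1) * (n - k)))"
      unfolding X_def w_def choose_add_double_Suc[symmetric] of_nat_mult ..
    also have "\<dots> = X k * ((int n + int k + 1) * (int n - int k))"
      using Suc.prems unfolding X_def by (simp only: of_nat_mult) (simp add: of_nat_diff)
    finally have "4 * X (Suc k) * w = X k * (4 * ((int n + int k + 1) * (int n - int k)))"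
      by simp
    also have "4 * ((int n + int k + 1) * (int n - int k)) = int p ^ 2 - (2 * int k + 1) ^ 2"
      by (simp add: p(2) algebra_simps power2_eq_square)
    finally show ?thesis .
  qed
  have "w * (C (Suc k) - (-16) ^ Suc k * X (Suc k)) =
      C (Suc k) * w + 4 * (-16) ^ k * (4 * X (Suc k) * w)"
    by (simp add: algebra_simps)
  also have "\<dots> = 4 * (2 * int k + 1) ^ 2 * (C k - (-16) ^ k * X k) +
      int p ^ 2 * (4 * (-16) ^ k * X k)"
    unfolding C X by (simp add: algebra_simps)
  also have "int p ^ 2 dvd \<dots>"
    using Suc by (intro dvd_add dvd_mult dvd_triv_left) (simp add: C_def X_def)
  finally have "int p ^ 2 dvd w * (C (Suc k) - (-16) ^ Suc k * X (Suc k))" .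
  \<comment> \<open>From \<open>Suc k \<le> n\<close> follows \<open>2 * k + 2 < p\<close>, so
    \<open>w\<close> may be cancelled modulo \<open>p ^ 2\<close>.\<close>
  moreover have "coprime (int p ^ 2) w"
  proof -
    have "coprime p (2 * k + 1)" "coprime p (2 * k + 2)"
      using Suc.prems p by (auto intro!: prime_imp_coprime dest: dvd_imp_le)
    then show ?thesis by (simp only: w_def coprime_power_left_iff coprime_int_iff coprime_mult_right_iff) simp
  qed
  ultimately show ?case
    by (simp only: coprime_dvd_mult_right_iff C_def X_def)
qed simp

section \<open>Periodicity and Legendre symbols\<close>

lemma lucas_one_add_period:
  assumes "lucas_one c t = 0" "lucas_one c (Suc t) = 1"
  shows "lucas_one c (n + t) = lucas_one c n"
proof -
  have "lucas_one c (n + t) = lucas_one c n \<and> lucas_one c (Suc n + t) = lucas_one c (Suc n)"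
    by (induction n) (use assms in simp_all)
  then show ?thesis ..
qed

lemma lucas_one_mod_period:
  assumes "lucas_one c t = 0" "lucas_one c (Suc t) = 1"
  shows "lucas_one c n = lucas_one c (n mod t)"
proof -
  have "lucas_one c (n mod t + q * t) = lucas_one c (n mod t)" for q
  proof (induction q)
    case (Suc q)
    then show ?case
      using lucas_one_add_period[OF assms, of "n mod t + q * t"] by (simp add: add_ac)
  qed simp
  from this[of "n div t"] show ?thesis by simp
qed

text \<open>Euler's criterion fixes the symbol modulo \<open>p\<close>, and two numbers from -1, 0,
  1 differ by at most \<open>2 < p\<close>.\<close>

lemma Legendre_eqI:
  assumes p: "prime p" "p = 2 * n + 1" and s: "s = 1 \<or> s = -1"
    and "int p dvd a ^ n - s"
  shows "Legendre a (int p) = s"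
proof -
  have "2 < p" using p prime_gt_1_nat[OF p(1)] by (cases n) auto
  have "[Legendre a (int p) = a ^ n] (mod int p)"
    using euler_criterion[OF p(1) \<open>2 < p\<close>, of a] p(2) by simp
  moreover have "[a ^ n = s] (mod int p)"
    using assms(4) by (simp add: cong_iff_dvd_diff)
  ultimately have "int p dvd Legendre a (int p) - s"
    by (metis cong_iff_dvd_diff cong_trans)
  moreover have "\<bar>Legendre a (int p) - s\<bar> \<le> 2"
    using s by (auto simp: Legendre_def)
  ultimately show ?thesis
    using \<open>2 < p\<close> zdvd_imp_le[of "int p" "\<bar>Legendre a (int p) - s\<bar>"] by auto
qed

lemma Legendre_minus_one:
  assumes p: "prime p" "p = 2 * n + 1"
  shows "Legendre (-1) (int p) = (-1) ^ n"
  using p by (rule Legendre_eqI) (simp_all add: minus_one_power_iff)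

lemma lucas_one_zero_mod: "lucas_one (0 :: 'a :: comm_ring_1) n = lucas_one 0 (n mod 4)"
  by (rule lucas_one_mod_period) (simp_all add: numeral_eq_Suc)

text \<open>The value \<open>c = 0\<close>, for which \<open>c + 2 = 2\<close>, evaluates \<open>2 ^ n\<close> modulo \<open>p\<close>; this is the
  classical argument with \<open>(1 + i) ^ p\<close>.\<close>

lemma Legendre_two:
  assumes p: "prime p" "p = 2 * n + 1"
  shows "Legendre 2 (int p) = (if n mod 4 = 0 \<or> n mod 4 = 3 then 1 else -1)"
proof (rule Legendre_eqI[OF p])
  let ?U = "lucas_one (0 :: int)"
  have vals: "?U 0 = 0" "?U 1 = 1" "?U 2 = 0" "?U 3 = -1"
    by (simp_all add: numeral_eq_Suc)
  have "int p dvd 2 ^ n * (?U n + ?U (n + 1)) - ?U p"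
    using prime_dvd_sum_choose_diff[OF p(1), of ?U]
    unfolding sum_choose_odd_lucas_one[of n "0 :: int", folded p(2)] by simp
  then have dvd: "int p dvd 2 ^ n * (?U (n mod 4) + ?U ((n + 1) mod 4)) - ?U (p mod 4)"
    by (simp only: lucas_one_zero_mod[symmetric])
  have mods: "p mod 4 = (2 * (n mod 4) + 1) mod 4" "(n + 1) mod 4 = (n mod 4 + 1) mod 4"
    unfolding p(2) by (metis mod_add_left_eq mod_mult_right_eq)+
  have "n mod 4 \<in> {0, 1, 2, 3}" by auto
  \<comment> \<open>In the classes 2 and 3 the factor of \<open>2 ^ n\<close> is -1; there the
    reversed difference has the required sign.\<close>
  with dvd dvd[THEN dvd_diff_commute[THEN iffD1]]
  show "int p dvd 2 ^ n - (if n mod 4 = 0 \<or> n mod 4 = 3 then 1 else -1)"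
    unfolding mods by (elim insertE emptyE) (simp_all add: vals add.commute)
qed auto

lemma Legendre_minus_two:
  assumes p: "prime p" "p = 2 * n + 1"
  shows "Legendre (-2) (int p) = (-1) ^ n * Legendre 2 (int p)"
proof (rule Legendre_eqI[OF p])
  have "2 < p" using p prime_gt_1_nat[OF p(1)] by (cases n) auto
  then have "int p dvd Legendre 2 (int p) - 2 ^ n"
    using euler_criterion[OF p(1), of 2] p(2) by (simp add: cong_iff_dvd_diff)
  then have "int p dvd (-1) ^ n * (2 ^ n - Legendre 2 (int p))"
    by (metis dvd_mult dvd_diff_commute)
  then show "int p dvd (-2) ^ n - (-1) ^ n * Legendre 2 (int p)"
    by (simp add: right_diff_distrib power_minus[of 2])
qed (auto simp: Legendre_two[OF p] minus_one_power_iff)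

section \<open>The ring \<int>[sqrt 2] and its linear forms\<close>

text \<open>The ring \<open>\<int>[sqrt 2]\<close> is made a type of its own because divisibility is trivial in a field
  such as \<open>real\<close>.\<close>

datatype zsqrt2 = Zsqrt2 (rat_part: int) (sqrt_part: int)

instantiation zsqrt2 :: comm_ring_1
begin

definition "0 = Zsqrt2 0 0"
definition "1 = Zsqrt2 1 0"
definition "x + y = Zsqrt2 (rat_part x + rat_part y) (sqrt_part x + sqrt_part y)"
definition "- x = Zsqrt2 (- rat_part x) (- sqrt_part x)"
definition "x - y = Zsqrt2 (rat_part x - rat_part y) (sqrt_part x - sqrt_part y)"
definition "x * y = Zsqrt2 (rat_part x * rat_part y + 2 * sqrt_part x * sqrt_part y)
  (rat_part x * sqrt_part y + sqrt_part x * rat_part y)"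

lemmas zsqrt2_defs = zero_zsqrt2_def one_zsqrt2_def plus_zsqrt2_def uminus_zsqrt2_def
  minus_zsqrt2_def times_zsqrt2_def

instance
  by standard (auto simp: zsqrt2_defs algebra_simps intro: zsqrt2.expand)

end

lemma of_int_zsqrt2: "of_int a = Zsqrt2 a 0"
proof -
  have "of_nat n = Zsqrt2 (int n) 0" for n
    by (induction n) (simp_all add: zsqrt2_defs)
  then show ?thesis
    by (cases a) (simp_all add: zsqrt2_defs del: of_nat_Suc)
qed

lemma numeral_zsqrt2: "numeral k = Zsqrt2 (numeral k) 0"
  using of_int_zsqrt2[of "numeral k"] by simp

text \<open>The general additive functional to the integers. With
  \<open>\<alpha> = 2 + sqrt 2\<close>, each of \<open>u k\<close>, \<open>u (k + 1)\<close> and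
  \<open>v k\<close> is such a form evaluated at \<open>\<alpha>^k\<close>, so one congruence in the
  ring serves several sums.\<close>

definition zsqrt2_form :: "int \<Rightarrow> int \<Rightarrow> zsqrt2 \<Rightarrow> int" where
  "zsqrt2_form r s x = r * rat_part x + s * sqrt_part x"

lemma zsqrt2_form_diff: "zsqrt2_form r s (x - y) = zsqrt2_form r s x - zsqrt2_form r s y"
  by (simp add: zsqrt2_form_def zsqrt2_defs algebra_simps)

lemma zsqrt2_form_of_int_mult: "zsqrt2_form r s (of_int a * x) = a * zsqrt2_form r s x"
  by (simp add: zsqrt2_form_def zsqrt2_defs of_int_zsqrt2 algebra_simps)

lemma zsqrt2_form_sum: "zsqrt2_form r s (sum f A) = (\<Sum>x\<in>A. zsqrt2_form r s (f x))"
proof -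
  have "zsqrt2_form r s 0 = 0"
    "zsqrt2_form r s (x + y) = zsqrt2_form r s x + zsqrt2_form r s y" for x y
    by (simp_all add: zsqrt2_form_def zsqrt2_defs algebra_simps)
  then show ?thesis
    by (induction A rule: infinite_finite_induct) simp_all
qed

lemma dvd_zsqrt2_form: "of_int d dvd x \<Longrightarrow> d dvd zsqrt2_form r s x"
  by (auto simp: zsqrt2_form_of_int_mult elim!: dvdE)

section \<open>From divisibility in the ring to rational congruences\<close>

lemma rat_congI:
  assumes "\<not> int p dvd w" "int m dvd z" "(x - y) * of_int w = of_int z"
  shows "rat_cong p m x y"
proof -
  obtain t where z: "z = int m * t" using assms(2) ..
  have "w \<noteq> 0" using assms(1) by auto
  then have "x - y = of_nat m * (of_int t / of_int w)"
    using assms(3) by (simp add: z field_simps)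
  moreover have "of_int t / of_int w \<in> localized_ints p"
    using assms(1) by (auto simp: localized_ints_def)
  ultimately show ?thesis unfolding rat_cong_def by blast
qed

text \<open>Multiplication by \<open>w ^ N\<close>, which is prime to \<open>p\<close>, clears all
  denominators; the linear form then carries divisibility by \<open>m\<close> from the ring to the
  integers.\<close>

lemma rat_cong_zsqrt2_form:
  fixes c :: "nat \<Rightarrow> nat" and a Q :: zsqrt2
  assumes p: "prime p" and w: "\<not> int p dvd w"
    and dvd: "of_int (int m) dvd (\<Sum>k\<le>N. of_nat (c k) * of_int w ^ (N - k) * a ^ k) - of_int w ^ N * Q"
  shows "rat_cong p m (\<Sum>k\<le>N. of_int (zsqrt2_form r s (a ^ k)) / of_int w ^ k * of_nat (c k))
    (of_int (zsqrt2_form r s Q))"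
proof (rule rat_congI)
  show "\<not> int p dvd w ^ N"
    using p w prime_dvd_power_int[of "int p" w N] by auto
  show "int m dvd (\<Sum>k\<le>N. (int (c k) * w ^ (N - k)) * zsqrt2_form r s (a ^ k))
      - w ^ N * zsqrt2_form r s Q"
  proof -
    have "of_int (int m) dvd (\<Sum>k\<le>N. of_int (int (c k) * w ^ (N - k)) * a ^ k) - of_int (w ^ N) * Q"
      using dvd by simp
    from dvd_zsqrt2_form[OF this, of r s] show ?thesis
      by (simp only: zsqrt2_form_diff zsqrt2_form_sum zsqrt2_form_of_int_mult)
  qed
  have "w \<noteq> 0" using w by auto
  then have "of_int (zsqrt2_form r s (a ^ k)) / of_int w ^ k * of_nat (c k) * of_int w ^ N =
      (of_nat (c k) * of_int w ^ (N - k) * of_int (zsqrt2_form r s (a ^ k)) :: rat)" if "k \<le> N" for k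
    using that by (simp add: power_diff field_simps)
  then show "((\<Sum>k\<le>N. of_int (zsqrt2_form r s (a ^ k)) / of_int w ^ k * of_nat (c k))
      - of_int (zsqrt2_form r s Q)) * of_int (w ^ N) =
    (of_int ((\<Sum>k\<le>N. (int (c k) * w ^ (N - k)) * zsqrt2_form r s (a ^ k))
      - w ^ N * zsqrt2_form r s Q) :: rat)"
    by (simp add: left_diff_distrib sum_distrib_right)
qed

text \<open>Multiplying by \<open>a ^ (p - 1)\<close> turns \<open>(c + 2) ^ (p - 1 - k)\<close>
  into \<open>w ^ (p - 1 - k) * a ^ k\<close>, without inverting anything in the ring.\<close>

lemma prime_square_dvd_sum_central_binomial_power:
  fixes a c w :: "'a :: comm_ring_1"
  assumes p: "prime p" "p = 2 * n + 1" and unit: "lucas_one c p ^ 2 = 1" and w: "a * (c + 2) = w"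
  shows "of_nat p ^ 2 dvd
    (\<Sum>k\<le>p - 1. of_nat (2 * k choose k) * w ^ (p - 1 - k) * a ^ k)
    - w ^ (p - 1) * (lucas_one c p * (lucas_one c n + lucas_one c (n + 1)) ^ 2)"
    (is "_ dvd ?S - _ * ?Q")
proof -
  have "of_nat p ^ 2 dvd a ^ (p - 1) *
      ((\<Sum>k<p. of_nat (2 * k choose k) * (c + 2) ^ (p - Suc k)) - (c + 2) ^ (p - 1) * ?Q)"
    using prime_square_dvd_sum_central_binomial_square[OF p unit] by (rule dvd_mult)
  also have "\<dots> = (\<Sum>k<p. of_nat (2 * k choose k) * (a ^ (p - 1) * (c + 2) ^ (p - Suc k)))
      - w ^ (p - 1) * ?Q"
    by (simp add: right_diff_distrib sum_distrib_left power_mult_distrib mult.left_commute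
        mult.assoc flip: w)
  also have "(\<Sum>k<p. of_nat (2 * k choose k) * (a ^ (p - 1) * (c + 2) ^ (p - Suc k))) = ?S"
  proof (rule sum.cong)
    show "{..<p} = {..p - 1}" using p(2) by auto
    fix k assume "k \<in> {..p - 1}"
    then have "p - 1 = (p - 1 - k) + k" by simp
    then have "a ^ (p - 1) = a ^ (p - 1 - k) * a ^ k" by (metis power_add)
    then show "of_nat (2 * k choose k) * (a ^ (p - 1) * (c + 2) ^ (p - Suc k)) =
        of_nat (2 * k choose k) * w ^ (p - 1 - k) * a ^ k"
      by (simp add: power_mult_distrib mult_ac flip: w)
  qed
  finally show ?thesis .
qed

text \<open>With \<open>y = - a\<close> in the Morgan-Voyce identity, the signs of
  \<open>(-16) ^ k\<close> and \<open>(- a) ^ k\<close> cancel.\<close>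

lemma prime_square_dvd_half_sum_central_binomial_power:
  fixes a :: "'a :: comm_ring_1"
  assumes p: "prime p" "p = 2 * n + 1"
  shows "of_nat p ^ 2 dvd
    (\<Sum>k\<le>n. of_nat (2 * k choose k) * 16 ^ (n - k) * a ^ k)
    - 16 ^ n * (lucas_one (2 - a) (Suc n) - lucas_one (2 - a) n)"
proof -
  have "16 ^ n * (lucas_one (2 - a) (Suc n) - lucas_one (2 - a) n) =
      (\<Sum>k\<le>n. of_int ((-16) ^ k * int (n + k choose (2 * k))) * 16 ^ (n - k) * a ^ k)"
    unfolding sum_choose_add_double[of n "- a", simplified, symmetric] sum_distrib_left
  proof (rule sum.cong)
    fix k assume "k \<in> {..n}"
    then have "n = (n - k) + k" by simp
    then have "(16 :: 'a) ^ n = 16 ^ (n - k) * 16 ^ k" by (metis power_add)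
    then show "16 ^ n * (of_nat (n + k choose (2 * k)) * (- a) ^ k) =
        of_int ((-16) ^ k * int (n + k choose (2 * k))) * 16 ^ (n - k) * a ^ k"
      by (simp add: power_minus[of a] power_minus[of "16 :: 'a"] mult_ac)
  qed simp
  then have "(\<Sum>k\<le>n. of_nat (2 * k choose k) * 16 ^ (n - k) * a ^ k)
      - 16 ^ n * (lucas_one (2 - a) (Suc n) - lucas_one (2 - a) n) =
    (\<Sum>k\<le>n. of_int (int (2 * k choose k) - (-16) ^ k * int (n + k choose (2 * k)))
      * (16 ^ (n - k) * a ^ k))"
    by (simp add: left_diff_distrib sum_subtractf mult.assoc)
  also have "of_nat p ^ 2 dvd \<dots>"
  proof (intro dvd_sum dvd_mult2)
    fix k assume "k \<in> {..n}"
    then have "int p ^ 2 dvd int (2 * k choose k) - (-16) ^ k * int (n + k choose (2 * k))"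
      using prime_square_dvd_choose_add_double_diff[OF p] by simp
    from of_int_dvd_of_int[OF this]
    show "of_nat p ^ 2 dvd
        (of_int (int (2 * k choose k) - (-16) ^ k * int (n + k choose (2 * k))) :: 'a)"
      by simp
  qed
  finally show ?thesis .
qed

section \<open>The parameter -sqrt 2 and the powers of 2 + sqrt 2\<close>

text \<open>Since \<open>-sqrt 2 = 2 cos (3 pi / 4)\<close>, the term of index \<open>k\<close> is
  \<open>sin (3 pi k / 4) / sin (3 pi / 4)\<close>, whence the period 8.\<close>

lemma lucas_one_minus_sqrt2:
  fixes c :: zsqrt2
  defines "c \<equiv> Zsqrt2 0 (-1)"
  shows "lucas_one c 0 = 0" "lucas_one c 1 = 1" "lucas_one c 2 = Zsqrt2 0 (-1)"
    "lucas_one c 3 = 1" "lucas_one c 4 = 0" "lucas_one c 5 = -1"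
    "lucas_one c 6 = Zsqrt2 0 1" "lucas_one c 7 = -1"
    and lucas_one_minus_sqrt2_mod: "lucas_one c k = lucas_one c (k mod 8)"
proof -
  have "lucas_one c 8 = 0" "lucas_one c (Suc 8) = 1"
    by (simp_all add: numeral_eq_Suc c_def zsqrt2_defs)
  then show "lucas_one c k = lucas_one c (k mod 8)"
    by (rule lucas_one_mod_period)
qed (simp_all add: numeral_eq_Suc c_def zsqrt2_defs)

text \<open>All three formulas are read off from
  \<open>\<alpha>^k = (u (k + 1) - 2 * u k) + u k * sqrt 2\<close> for
  \<open>\<alpha> = 2 + sqrt 2\<close>; \<open>v k\<close> is its trace, twice the rational
  part.\<close>

lemma zsqrt2_power_lucas:
  fixes u v :: "nat \<Rightarrow> int"
  assumes u: "u 0 = 0" "u 1 = 1" "\<And>n. n \<ge> 1 \<Longrightarrow> u (n + 1) = 4 * u n - 2 * u (n - 1)"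
    and v: "v 0 = 2" "v 1 = 4" "\<And>n. n \<ge> 1 \<Longrightarrow> v (n + 1) = 4 * v n - 2 * v (n - 1)"
  shows "u k = zsqrt2_form 0 1 (Zsqrt2 2 1 ^ k)" "u (k + 1) = zsqrt2_form 1 2 (Zsqrt2 2 1 ^ k)"
    "v k = zsqrt2_form 2 0 (Zsqrt2 2 1 ^ k)"
proof -
  have u': "u (Suc (Suc k)) = 4 * u (Suc k) - 2 * u k" for k
    using u(3)[of "Suc k"] by simp
  have v': "v (Suc (Suc k)) = 4 * v (Suc k) - 2 * v k" for k
    using v(3)[of "Suc k"] by simp
  have power: "Zsqrt2 2 1 ^ k = Zsqrt2 (u (Suc k) - 2 * u k) (u k)" for k
    by (induction k) (use u(1,2) in \<open>simp_all add: u' zsqrt2_defs\<close>)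
  have "v k = 2 * (u (Suc k) - 2 * u k) \<and> v (Suc k) = 2 * (u (Suc (Suc k)) - 2 * u (Suc k))"
    by (induction k) (use u(1,2) v(1,2) in \<open>simp_all add: u' v'\<close>)
  then show "u k = zsqrt2_form 0 1 (Zsqrt2 2 1 ^ k)" "u (k + 1) = zsqrt2_form 1 2 (Zsqrt2 2 1 ^ k)"
    "v k = zsqrt2_form 2 0 (Zsqrt2 2 1 ^ k)"
    by (simp_all add: power zsqrt2_form_def)
qed

theorem theorem1p4:
  fixes p :: nat and u v :: "nat \<Rightarrow> int"
  assumes "prime p" and "odd p"
    and "u 0 = 0" and "u 1 = 1"
    and "\<And>n. n \<ge> 1 \<Longrightarrow> u (n + 1) = 4 * u n - 2 * u (n - 1)"
    and "v 0 = 2" and "v 1 = 4"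
    and "\<And>n. n \<ge> 1 \<Longrightarrow> v (n + 1) = 4 * v n - 2 * v (n - 1)"
  shows "rat_cong p (p ^ 2)
           (\<Sum>k=0..p - 1. of_int (u k) / 2 ^ k * of_nat ((2 * k) choose k))
           (of_int (Legendre (-1) (int p) - Legendre (-2) (int p)))
       \<and> rat_cong p (p ^ 2)
           (\<Sum>k=0..p - 1. of_int (u (k + 1)) / 2 ^ k * of_nat ((2 * k) choose k))
           (of_int (Legendre (-1) (int p)))
       \<and> rat_cong p (p ^ 2)
           (\<Sum>k=0..(p - 1) div 2. of_int (u k) / 16 ^ k * of_nat ((2 * k) choose k))
           ((-1) powi \<lfloor>(of_nat p - 4) / 8 :: rat\<rfloor> / 2 * (1 - of_int (Legendre 2 (int p))))
       \<and> rat_cong p (p ^ 2)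
           (\<Sum>k=0..(p - 1) div 2. of_int (v k) / 16 ^ k * of_nat ((2 * k) choose k))
           (2 * (-1) powi \<lfloor>of_nat p / 8 :: rat\<rfloor> * of_int (Legendre (-1) (int p)))"
proof -
  \<comment> \<open>\<open>a\<close> is a root of \<open>x^2 - 4 x + 2\<close> and \<open>c + 2\<close> is its conjugate.\<close>
  define c where "c = Zsqrt2 0 (-1)"
  define a where "a = Zsqrt2 2 1"
  define n where "n = (p - 1) div 2"
  note p = \<open>prime p\<close>
  have pn: "p = 2 * n + 1" using \<open>odd p\<close> unfolding n_def by presburger
  have lucas: "u k = zsqrt2_form 0 1 (a ^ k)" "u (k + 1) = zsqrt2_form 1 2 (a ^ k)"
    "v k = zsqrt2_form 2 0 (a ^ k)" for k
    unfolding a_def by (rule zsqrt2_power_lucas[of u v]; use assms in simp)+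
  have vals: "lucas_one c 0 = 0" "lucas_one c 1 = 1" "lucas_one c 2 = Zsqrt2 0 (-1)"
    "lucas_one c 3 = 1" "lucas_one c 4 = 0" "lucas_one c 5 = -1"
    "lucas_one c 6 = Zsqrt2 0 1" "lucas_one c 7 = -1"
    and vals_mod: "lucas_one c k = lucas_one c (k mod 8)" for k
    unfolding c_def by (rule lucas_one_minus_sqrt2)+
  define Q where "Q = lucas_one c p * (lucas_one c n + lucas_one c (n + 1)) ^ 2"
  define R where "R = lucas_one c (n + 1) - lucas_one c n"
  \<comment> \<open>The period 8 leaves only the class of \<open>n\<close> modulo 8 to
    consider.\<close>
  define q where "q = n div 8"
  define r where "r = n mod 8"
  have n: "n = 8 * q + r" and "r < 8" by (simp_all add: q_def r_def)
  then have r: "r \<in> {0, 1, 2, 3, 4, 5, 6, 7}" by auto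
  have "n mod 8 = r mod 8" "(n + 1) mod 8 = (r + 1) mod 8" "p mod 8 = (2 * r + 1) mod 8"
    unfolding pn r_def by (metis mod_add_left_eq mod_mult_right_eq mod_mod_trivial)+
  then have lucas_mod: "lucas_one c n = lucas_one c (r mod 8)"
    "lucas_one c (n + 1) = lucas_one c ((r + 1) mod 8)"
    "lucas_one c p = lucas_one c ((2 * r + 1) mod 8)"
    by (metis vals_mod)+

  \<comment> \<open>The index \<open>p\<close> is odd, and at odd indices the sequence takes only
    the values 1 and -1.\<close>
  have unit: "lucas_one c p ^ 2 = 1"
    using r unfolding lucas_mod
    by (elim insertE emptyE) (simp_all add: vals)
  have "\<not> int p dvd 2"
    using pn prime_gt_1_nat[OF p] by (auto dest!: zdvd_imp_le)
  have full: "rat_cong p (p ^ 2)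
      (\<Sum>k\<le>p - 1. of_int (zsqrt2_form s t (a ^ k)) / 2 ^ k * of_nat (2 * k choose k))
      (of_int (zsqrt2_form s t Q))" for s t
  proof -
    have "a * (c + 2) = 2" by (simp add: a_def c_def numeral_zsqrt2 zsqrt2_defs)
    from prime_square_dvd_sum_central_binomial_power[OF p pn unit this]
    show ?thesis
      using rat_cong_zsqrt2_form[OF p \<open>\<not> int p dvd 2\<close>, where m = "p ^ 2" and N = "p - 1"
          and c = "\<lambda>k. 2 * k choose k" and a = a and Q = Q and r = s and s = t]
      by (simp add: Q_def)
  qed
  have half: "rat_cong p (p ^ 2)
      (\<Sum>k\<le>n. of_int (zsqrt2_form s t (a ^ k)) / 16 ^ k * of_nat (2 * k choose k))
      (of_int (zsqrt2_form s t R))" for s t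
  proof -
    have "2 - a = c" by (simp add: a_def c_def numeral_zsqrt2 zsqrt2_defs)
    moreover have "\<not> int p dvd 16"
      using \<open>\<not> int p dvd 2\<close> prime_dvd_power_int[of "int p" 2 4] p by auto
    ultimately show ?thesis
      using prime_square_dvd_half_sum_central_binomial_power[OF p pn, of a]
        rat_cong_zsqrt2_form[OF p, where w = 16 and m = "p ^ 2" and N = n
          and c = "\<lambda>k. 2 * k choose k" and a = a and Q = R and r = s and s = t]
      by (simp add: R_def)
  qed

  have "n mod 4 = r mod 4" "even n \<longleftrightarrow> even r"
    using mod_mult_self2[of r 4 "2 * q"] by (simp_all add: n add.commute)
  then have legendre: "Legendre (-1) (int p) = (if even r then 1 else -1)"
    "Legendre 2 (int p) = (if r mod 4 = 0 \<or> r mod 4 = 3 then 1 else -1)"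
    "Legendre (-2) (int p) = Legendre (-1) (int p) * Legendre 2 (int p)"
    using Legendre_minus_one[OF p pn] Legendre_two[OF p pn] Legendre_minus_two[OF p pn]
    by (simp_all add: minus_one_power_iff)
  \<comment> \<open>Here \<open>p = 16 * q + 2 * r + 1\<close>. Integer \<open>div\<close> rounds
    down like the floor, so \<open>p = 3\<close> gives -1 in the first formula. The summand
    \<open>2 * int q\<close> is even and does not affect the sign.\<close>
  have floors: "\<lfloor>(of_nat p - 4) / 8 :: rat\<rfloor> = 2 * int q + (2 * int r - 3) div 8"
    "\<lfloor>of_nat p / 8 :: rat\<rfloor> = 2 * int q + (2 * int r + 1) div 8"
  proof -
    have "\<lfloor>(of_int x / 8 :: rat)\<rfloor> = x div 8" for x
      using floor_divide_of_int_eq[of x 8] by simp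
    from this[of "int p - 4"] this[of "int p"]
    show "\<lfloor>(of_nat p - 4) / 8 :: rat\<rfloor> = 2 * int q + (2 * int r - 3) div 8"
      "\<lfloor>of_nat p / 8 :: rat\<rfloor> = 2 * int q + (2 * int r + 1) div 8"
      by (simp_all add: pn n)
  qed
  have powi_even: "(-1 :: rat) powi (2 * int q + x) = (-1) powi x" for x
    by (simp add: power_int_add power_int_mult)
  have c_parts: "rat_part c = 0" "sqrt_part c = -1" by (simp_all add: c_def)
  \<comment> \<open>Both sides now depend on \<open>r\<close> alone, so eight evaluations decide
    each identity.\<close>
  have full_vals: "zsqrt2_form 0 1 Q = Legendre (-1) (int p) - Legendre (-2) (int p) \<and>
    zsqrt2_form 1 2 Q = Legendre (-1) (int p)"
    using r unfolding Q_def lucas_mod legendre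
    by (elim insertE emptyE)
       (simp_all add: vals c_parts zsqrt2_form_def zsqrt2_defs power2_eq_square)
  have half_vals: "of_int (zsqrt2_form 0 1 R) =
      ((-1) powi \<lfloor>(of_nat p - 4) / 8 :: rat\<rfloor> / 2 * (1 - of_int (Legendre 2 (int p))) :: rat) \<and>
    of_int (zsqrt2_form 2 0 R) =
      (2 * (-1) powi \<lfloor>of_nat p / 8 :: rat\<rfloor> * of_int (Legendre (-1) (int p)) :: rat)"
    using r unfolding R_def lucas_mod legendre floors powi_even
    by (elim insertE emptyE)
       (simp_all add: vals c_parts zsqrt2_form_def zsqrt2_defs power_int_minus)
  show ?thesis
    using full[of 0 1] full[of 1 2] half[of 0 1] half[of 2 0]
    unfolding atLeast0AtMost n_def[symmetric]
    by (simp only: lucas[symmetric] full_vals half_vals simp_thms)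
qed

end
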